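(* Let $L_o(3)$ denote the language of all finite words over the alphabet $\{0,1,2\}$ that contain an overlap as a subword. Then $L_o(3)$ is not context-free.
   Context: An overlap is a word of the form $axaxa$, where $a$ is a single letter and $x$ is a (possibly empty) word. "Subword" means contiguous block (factor): $u$ is a subword of $w$ if $w = puq$ for some (possibly empty) words $p,q$. *)

theory Defs
  imports Main "HOL-Library.Sublist"
begin

datatype ('n, 't) sym = Nt 'n | Tm 't

type_synonym ('n, 't) prods = "('n \<times> ('n, 't) sym list) set"

inductive derive1 :: "('n, 't) prods \<Rightarrow> ('n, 't) sym list \<Rightarrow> ('n, 't) sym list \<Rightarrow> bool"
  for P where
  "(A, \<alpha>) \<in> P \<Longrightarrow> derive1 P (u @ [Nt A] @ v) (u @ \<alpha> @ v)"

definition lang :: "('n, 't) prods \<Rightarrow> 'n \<Rightarrow> 't list set" where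
  "lang P S = {w. (derive1 P)\<^sup>*\<^sup>* [Nt S] (map Tm w)}"

(* Nonterminals are drawn from nat because HOL cannot quantify over types inside a
   definition. This loses no generality: see context_free_lang below. A finite set of
   productions mentions only finitely many nonterminals and terminals, so the finiteness
   of both alphabets needs no separate condition. *)
definition context_free :: "'t list set \<Rightarrow> bool" where
  "context_free L \<longleftrightarrow> (\<exists>(P :: (nat, 't) prods) S. finite P \<and> L = lang P S)"

definition overlap :: "'a list \<Rightarrow> bool" where
  "overlap w \<longleftrightarrow> (\<exists>a x. w = [a] @ x @ [a] @ x @ [a])"

definition overlap_lang :: "nat \<Rightarrow> nat list set" where
  "overlap_lang k = {w. set w \<subseteq> {..<k} \<and> (\<exists>u. sublist u w \<and> overlap u)}"

definition map_prods :: "('n \<Rightarrow> 'm) \<Rightarrow> ('n, 't) prods \<Rightarrow> ('m, 't) prods" where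
  "map_prods f P = map_prod f (map (map_sym f id)) ` P"

lemma derive1_map_prods:
  assumes "derive1 P u v"
  shows "derive1 (map_prods f P) (map (map_sym f id) u) (map (map_sym f id) v)"
  using assms
proof cases
  case (1 A \<alpha> p q)
  have "(f A, map (map_sym f id) \<alpha>) \<in> map_prods f P"
    using 1(3) unfolding map_prods_def by force
  then show ?thesis
    using derive1.intros[of "f A" "map (map_sym f id) \<alpha>" "map_prods f P"
        "map (map_sym f id) p" "map (map_sym f id) q"] 1 by simp
qed

lemma lang_map_prods: "lang P S \<subseteq> lang (map_prods f P) (f S)"
proof
  fix w assume "w \<in> lang P S"
  then have "(derive1 P)\<^sup>*\<^sup>* [Nt S] (map Tm w)" by (simp add: lang_def)
  then have "(derive1 (map_prods f P))\<^sup>*\<^sup>* (map (map_sym f id) [Nt S])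
      (map (map_sym f id) (map Tm w))"
  proof (induction rule: rtranclp_induct)
    case (step y z)
    show ?case
      by (rule rtranclp.rtrancl_into_rtrancl[OF step.IH derive1_map_prods[OF step.hyps(2)]])
  qed (rule rtranclp.rtrancl_refl)
  then show "w \<in> lang (map_prods f P) (f S)"
    by (simp add: lang_def comp_def)
qed

lemma context_free_lang:
  fixes P :: "('n, 't) prods"
  assumes "finite P"
  shows "context_free (lang P S)"
proof -
  define N where "N = insert S (fst ` P \<union> (\<Union>p\<in>P. \<Union>s\<in>set (snd p). set1_sym s))"
  have "finite (set1_sym s)" for s :: "('n, 't) sym" by (cases s) auto
  then have "finite N" using assms by (auto simp: N_def)
  then obtain f :: "'n \<Rightarrow> nat" where f: "inj_on f N"
    using finite_imp_inj_to_nat_seg by blast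
  define g where "g = inv_into N f"
  have gf: "g (f A) = A" if "A \<in> N" for A
    using f that by (simp add: g_def)
  have sym: "map_sym g id (map_sym f id s) = s" if "p \<in> P" "s \<in> set (snd p)" for p s
  proof (cases s)
    case (Nt A)
    then have "A \<in> N" using that by (force simp: N_def)
    then show ?thesis using Nt gf by simp
  qed simp
  have "map_prod g (map (map_sym g id)) (map_prod f (map (map_sym f id)) p) = p"
    if "p \<in> P" for p
  proof -
    have "fst p \<in> N" using that by (auto simp: N_def)
    moreover have "map (map_sym g id \<circ> map_sym f id) (snd p) = snd p"
      using sym[OF that] by (simp add: map_idI)
    ultimately show ?thesis using gf by (cases p) simp
  qed
  then have "map_prods g (map_prods f P) = P"
    unfolding map_prods_def image_image by simp
  moreover have "g (f S) = S" using gf by (simp add: N_def)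
  ultimately have "lang (map_prods f P) (f S) \<subseteq> lang P S"
    using lang_map_prods[of "map_prods f P" "f S" g] by simp
  then have "lang P S = lang (map_prods f P) (f S)"
    using lang_map_prods[of P S f] by blast
  moreover have "finite (map_prods f P)" using assms by (simp add: map_prods_def)
  ultimately show ?thesis unfolding context_free_def by blast
qed

end

theory Submission
  imports Defs
begin

text \<open>
  The proof swaps factors between words, in the manner of the interchange lemma for context-free
  languages. If a grammar generates a long word \<open>w\<close>, then descending in a parse tree from the root,
  always to a child with a large share of the yield, one meets a nonterminal whose yield is a factor
  of \<open>w\<close> of any prescribed order of magnitude (lemma \<open>yields_medium_factor\<close>). Two words
  \<open>u x v\<close> and \<open>u' x' v'\<close> cut at the same positions and at the same nonterminal may exchange these
  factors: \<open>u x' v\<close> is generated as well. The number of possible cuts of a word of length \<open>n\<close> is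
  only quadratic in \<open>n\<close>, so every larger family of words of length \<open>n\<close> has two members that can
  be interchanged.

  Pumping is of no use here, since it creates overlaps. What is needed is a large family of words
  \<open>a x a x a\<close> for which exchanging factors of two distinct members destroys the overlap and creates
  no other. Take the Thue-Morse block \<open>r\<close> of length \<open>2 ^ k\<close>. In the periodic sequence
  \<open>r r r ...\<close> no overlap has a period below \<open>2 ^ k\<close> (lemma \<open>tm_overlap_period\<close>), so the word
  \<open>r r 0\<close> of length \<open>2 * 2 ^ k + 1\<close> has no overlap but itself. Now replace, at will, some of the
  letters \<open>1\<close> by \<open>2\<close>, in the same way in both copies of \<open>r\<close>. Identifying \<open>1\<close> and \<open>2\<close> turns
  overlaps into overlaps, so every mixture of two such words still has no overlap except possibly
  itself; and if it is an overlap, each letter of the exchanged factor, which is taken no longer than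
  \<open>2 ^ k\<close>, equals the one at distance \<open>2 ^ k\<close> outside of it. Hence the two exchanged factors were equal
  (lemma \<open>interchanged_window_eq\<close>).

  It remains to choose the replacements so that every medium-sized factor reveals the entire word.
  For this a set \<open>D\<close> of residues modulo \<open>b\<close> says in which pairs of adjacent positions the \<open>1\<close> becomes a
  \<open>2\<close>. With \<open>b = 2 ^ e\<close> and \<open>k = 2 * e\<close>, every factor of length \<open>2 * b + 1\<close> determines \<open>D\<close>, while
  there are \<open>2 ^ b\<close> choices of \<open>D\<close>, far more than the number of cuts, which is of order \<open>b ^ 4\<close>.
\<close>

section \<open>Interchanging factors in a context-free language\<close>

text \<open>
  The yield relation of parse forests. It decomposes a derivation along its tree rather
  than along the order of its steps, which is what the descent in the tree needs.
\<close>

inductive yields :: "('n, 't) prods \<Rightarrow> ('n, 't) sym list \<Rightarrow> 't list \<Rightarrow> bool" for P where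
  yields_Nil: "yields P [] []"
| yields_Tm: "yields P \<alpha> w \<Longrightarrow> yields P (Tm a # \<alpha>) (a # w)"
| yields_Nt: "(A, \<beta>) \<in> P \<Longrightarrow> yields P \<beta> v \<Longrightarrow> yields P \<alpha> w \<Longrightarrow> yields P (Nt A # \<alpha>) (v @ w)"

lemma yields_append:
  assumes "yields P \<alpha> v" and "yields P \<beta> w"
  shows "yields P (\<alpha> @ \<beta>) (v @ w)"
  using assms(1)
proof induction
  case (yields_Nt A \<gamma> v' \<alpha> w')
  then show ?case using yields.yields_Nt[of A \<gamma> P v' "\<alpha> @ \<beta>" "w' @ w"] by simp
qed (use assms(2) in \<open>simp_all add: yields_Tm\<close>)

lemma yields_appendD:
  assumes "yields P (\<alpha> @ \<beta>) w"
  obtains w1 w2 where "w = w1 @ w2" "yields P \<alpha> w1" "yields P \<beta> w2"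
proof -
  have "\<exists>w1 w2. w = w1 @ w2 \<and> yields P \<alpha> w1 \<and> yields P \<beta> w2"
    using assms
  proof (induction \<alpha> arbitrary: w)
    case Nil
    then show ?case by (metis append_Nil yields_Nil)
  next
    case (Cons X \<alpha>)
    from Cons.prems have "yields P (X # \<alpha> @ \<beta>) w" by simp
    then show ?case
    proof cases
      case (yields_Tm w' a)
      with Cons.IH obtain w1 w2 where "w' = w1 @ w2" "yields P \<alpha> w1" "yields P \<beta> w2" by blast
      with yields_Tm show ?thesis
        using yields.yields_Tm[of P \<alpha> w1 a] by (intro exI[of _ "a # w1"] exI[of _ w2]) simp
    next
      case (yields_Nt A \<gamma> v w')
      with Cons.IH obtain w1 w2 where "w' = w1 @ w2" "yields P \<alpha> w1" "yields P \<beta> w2" by blast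
      with yields_Nt show ?thesis
        using yields.yields_Nt[of A \<gamma> P v \<alpha> w1] by (intro exI[of _ "v @ w1"] exI[of _ w2]) simp
    qed
  qed
  then show thesis using that by blast
qed

lemma yields_terminals: "yields P (map Tm w) w"
  by (induction w) (auto intro: yields.intros)

lemma derive1_yields:
  assumes "derive1 P \<alpha> \<beta>" and "yields P \<beta> w"
  shows "yields P \<alpha> w"
  using assms(1)
proof cases
  case (1 A \<gamma> u v)
  from assms(2) have "yields P (u @ \<gamma> @ v) w" using 1(2) by simp
  then obtain w1 w' where w': "w = w1 @ w'" "yields P u w1" "yields P (\<gamma> @ v) w'"
    by (rule yields_appendD)
  from w'(3) obtain w2 w3 where "w' = w2 @ w3" "yields P \<gamma> w2" "yields P v w3"
    by (rule yields_appendD)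
  then have w: "w = w1 @ w2 @ w3" "yields P u w1" "yields P \<gamma> w2" "yields P v w3"
    using w' by simp_all
  have "yields P (Nt A # v) (w2 @ w3)" by (rule yields_Nt[OF 1(3) w(3,4)])
  with w(2) have "yields P (u @ Nt A # v) (w1 @ w2 @ w3)" by (rule yields_append)
  then show ?thesis using 1(1) w(1) by simp
qed

lemma derive1_context: "derive1 P \<alpha> \<beta> \<Longrightarrow> derive1 P (u @ \<alpha> @ v) (u @ \<beta> @ v)"
proof (induction rule: derive1.induct)
  case (1 A \<gamma> p q)
  then show ?case using derive1.intros[of A \<gamma> P "u @ p" "q @ v"] by simp
qed

lemma derives_context:
  "(derive1 P)\<^sup>*\<^sup>* \<alpha> \<beta> \<Longrightarrow> (derive1 P)\<^sup>*\<^sup>* (u @ \<alpha> @ v) (u @ \<beta> @ v)"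
proof (induction rule: rtranclp_induct)
  case base
  show ?case by (rule rtranclp.rtrancl_refl)
next
  case (step y z)
  show ?case
    by (rule rtranclp.rtrancl_into_rtrancl[OF step.IH derive1_context[OF step.hyps(2)]])
qed

lemma yields_derives: "yields P \<alpha> w \<Longrightarrow> (derive1 P)\<^sup>*\<^sup>* \<alpha> (map Tm w)"
proof (induction rule: yields.induct)
  case yields_Nil
  show ?case by simp
next
  case (yields_Tm \<alpha> w a)
  then show ?case using derives_context[of P \<alpha> "map Tm w" "[Tm a]" "[]"] by simp
next
  case (yields_Nt A \<beta> v \<alpha> w)
  have "derive1 P (Nt A # \<alpha>) (\<beta> @ \<alpha>)"
    using derive1.intros[OF yields_Nt(1), of "[]" \<alpha>] by simp
  also have "(derive1 P)\<^sup>*\<^sup>* (\<beta> @ \<alpha>) (map Tm v @ \<alpha>)"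
    using derives_context[OF yields_Nt(4), of "[]" \<alpha>] by simp
  also have "(derive1 P)\<^sup>*\<^sup>* (map Tm v @ \<alpha>) (map Tm v @ map Tm w)"
    using derives_context[OF yields_Nt(5), of "map Tm v" "[]"] by simp
  finally show ?case by simp
qed

lemma lang_iff_yields: "w \<in> lang P S \<longleftrightarrow> yields P [Nt S] w"
proof
  assume "w \<in> lang P S"
  then have "(derive1 P)\<^sup>*\<^sup>* [Nt S] (map Tm w)" by (simp add: lang_def)
  then show "yields P [Nt S] w"
    by (induction rule: converse_rtranclp_induct) (fact yields_terminals, rule derive1_yields)
next
  assume "yields P [Nt S] w"
  from yields_derives[OF this] show "w \<in> lang P S" by (simp add: lang_def)
qed

text \<open>
  Descent in the parse tree. If the symbols of \<open>\<alpha>\<close> yield more than \<open>m / d\<close> letters on average, then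
  one of them yields more than \<open>m / d\<close> letters, and because \<open>d \<le> m\<close> it is a nonterminal. If its
  yield has at most \<open>m\<close> letters, the descent ends. Otherwise the right-hand side of its production,
  having at most \<open>d\<close> symbols, again yields more than \<open>m / d\<close> letters on average. The quantification
  over all \<open>x'\<close> records that the subtree at the chosen nonterminal may be exchanged for any other.
\<close>

lemma yields_medium_factor:
  assumes short: "\<forall>(A, \<beta>)\<in>P. length \<beta> \<le> d" and "d \<le> m"
    and "yields P \<alpha> w" and "length \<alpha> * m < d * length w"
  shows "\<exists>B u x v. B \<in> fst ` P \<and> w = u @ x @ v \<and> length x \<le> m \<and> m < d * length x \<and>
    yields P [Nt B] x \<and> (\<forall>x'. yields P [Nt B] x' \<longrightarrow> yields P \<alpha> (u @ x' @ v))"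
  using assms(3,4)
proof (induction rule: yields.induct)
  case yields_Nil
  then show ?case by simp
next
  case (yields_Tm \<alpha> w a)
  then have "length \<alpha> * m < d * length w" using \<open>d \<le> m\<close> by simp
  then obtain B u x v where *: "B \<in> fst ` P" "w = u @ x @ v" "length x \<le> m" "m < d * length x"
    "yields P [Nt B] x" "\<And>x'. yields P [Nt B] x' \<Longrightarrow> yields P \<alpha> (u @ x' @ v)"
    using yields_Tm.IH by blast
  have "yields P (Tm a # \<alpha>) ((a # u) @ x' @ v)" if "yields P [Nt B] x'" for x'
    using yields.yields_Tm[OF *(6)[OF that]] by simp
  then show ?case using * by (intro exI[of _ B] exI[of _ "a # u"] exI[of _ x] exI[of _ v]) simp
next
  case (yields_Nt A \<beta> y \<alpha> w)
  consider (tail) "length \<alpha> * m < d * length w" | (deep) "m < length y"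
    | (found) "m < d * length y" "length y \<le> m"
    using yields_Nt.prems by (fastforce simp: algebra_simps not_less)
  then show ?case
  proof cases
    case tail
    then obtain B u x v where *: "B \<in> fst ` P" "w = u @ x @ v" "length x \<le> m" "m < d * length x"
      "yields P [Nt B] x" "\<And>x'. yields P [Nt B] x' \<Longrightarrow> yields P \<alpha> (u @ x' @ v)"
      using yields_Nt.IH(2) by blast
    have "yields P (Nt A # \<alpha>) ((y @ u) @ x' @ v)" if "yields P [Nt B] x'" for x'
      using yields.yields_Nt[OF yields_Nt.hyps(1,2) *(6)[OF that]] by simp
    then show ?thesis
      using * by (intro exI[of _ B] exI[of _ "y @ u"] exI[of _ x] exI[of _ v]) simp
  next
    case deep
    have "length \<beta> \<le> d" using short yields_Nt.hyps(1) by blast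
    have "\<beta> \<noteq> []" using deep yields_Nt.hyps(2) by (auto elim: yields.cases)
    then have "0 < d" using \<open>length \<beta> \<le> d\<close> by (cases \<beta>) auto
    have "length \<beta> * m \<le> d * m" using \<open>length \<beta> \<le> d\<close> by simp
    also have "\<dots> < d * length y" using deep \<open>0 < d\<close> by simp
    finally obtain B u x v where *: "B \<in> fst ` P" "y = u @ x @ v" "length x \<le> m"
      "m < d * length x" "yields P [Nt B] x"
      "\<And>x'. yields P [Nt B] x' \<Longrightarrow> yields P \<beta> (u @ x' @ v)"
      using yields_Nt.IH(1) by blast
    have "yields P (Nt A # \<alpha>) (u @ x' @ (v @ w))" if "yields P [Nt B] x'" for x'
      using yields.yields_Nt[OF yields_Nt.hyps(1) *(6)[OF that] yields_Nt.hyps(3)] by simp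
    then show ?thesis
      using * by (intro exI[of _ B] exI[of _ u] exI[of _ x] exI[of _ "v @ w"]) simp
  next
    case found
    have "yields P (Nt A # \<alpha>) ([] @ x' @ w)" if x': "yields P [Nt A] x'" for x'
      using yields_append[OF x' yields_Nt.hyps(3)] by simp
    moreover have "yields P [Nt A] y"
      using yields.yields_Nt[OF yields_Nt.hyps(1,2) yields_Nil] by simp
    moreover have "A \<in> fst ` P" using yields_Nt.hyps(1) by force
    ultimately show ?thesis
      using found by (intro exI[of _ A] exI[of _ "[]"] exI[of _ y] exI[of _ w]) simp
  qed
qed

text \<open>
  The exchanged factors are bounded from above in order to fit into one period of an overlap, and
  from below, by \<open>m / d\<close>, in order to carry enough information about the word.
\<close>

definition interchangeable :: "'a list set \<Rightarrow> nat \<Rightarrow> nat \<Rightarrow> 'a list set \<Rightarrow> bool" where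
  "interchangeable L d m Q \<longleftrightarrow> (\<exists>u x v u' x' v'.
    u @ x @ v \<in> Q \<and> u' @ x' @ v' \<in> Q \<and> u @ x @ v \<noteq> u' @ x' @ v' \<and>
    length u = length u' \<and> length x = length x' \<and> length x \<le> m \<and> m < d * length x \<and>
    u @ x' @ v \<in> L)"

text \<open>
  A cut is recorded by the nonterminal above the factor and by the position and length of the
  factor, which leaves at most \<open>c * (n + 1)\<^sup>2\<close> cuts for the words of length \<open>n\<close>, where \<open>c\<close> is the
  number of nonterminals; the conclusion is the pigeonhole principle.
\<close>

lemma context_free_interchange:
  assumes "context_free L"
  obtains d c :: nat where
    "\<And>n m Q. \<lbrakk>d \<le> m; m < n; Q \<subseteq> L; finite Q; \<forall>w\<in>Q. length w = n; c * (n + 1)\<^sup>2 < card Q\<rbrakk> \<Longrightarrow>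
      interchangeable L d m Q"
proof -
  obtain P :: "(nat, 'a) prods" and S where P: "finite P" and L: "L = lang P S"
    using assms unfolding context_free_def by blast
  define d where "d = Suc (Max (insert 0 ((length \<circ> snd) ` P)))"
  have short: "\<forall>(A, \<beta>)\<in>P. length \<beta> \<le> d"
    using P by (force simp: d_def intro: le_SucI Max_ge)
  define N where "N = fst ` P"
  show thesis
  proof (rule that[of d "card N"])
    fix n m Q
    assume "d \<le> m" and "m < n" and QL: "Q \<subseteq> L" and "finite Q"
      and lens: "\<forall>w\<in>Q. length w = n" and many: "card N * (n + 1)\<^sup>2 < card Q"
    have len: "length w = n" if "w \<in> Q" for w using lens that by blast
    define is_cut where "is_cut w q \<longleftrightarrow> (case q of (B, i, l) \<Rightarrow> B \<in> N \<and>
      (\<exists>u x v. w = u @ x @ v \<and> length u = i \<and> length x = l \<and> l \<le> m \<and> m < d * l \<and>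
        yields P [Nt B] x \<and> (\<forall>x'. yields P [Nt B] x' \<longrightarrow> u @ x' @ v \<in> L)))" for w q
    have "\<exists>q. is_cut w q" if "w \<in> Q" for w
    proof -
      have y: "yields P [Nt S] w" using that QL by (auto simp: L lang_iff_yields)
      have "n \<le> d * n" by (simp add: d_def)
      with \<open>m < n\<close> have "m < d * n" by linarith
      then have "length [Nt S :: (nat, 'a) sym] * m < d * length w" using len[OF that] by simp
      from yields_medium_factor[OF short \<open>d \<le> m\<close> y this]
      obtain B u x v where "B \<in> N" "w = u @ x @ v" "length x \<le> m" "m < d * length x"
        "yields P [Nt B] x" "\<forall>x'. yields P [Nt B] x' \<longrightarrow> yields P [Nt S] (u @ x' @ v)"
        unfolding N_def by blast
      then have "is_cut w (B, length u, length x)"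
        unfolding is_cut_def prod.case L lang_iff_yields
        by (intro conjI exI[of _ u] exI[of _ x] exI[of _ v]) simp_all
      then show ?thesis ..
    qed
    then obtain cut where "\<forall>w\<in>Q. is_cut w (cut w)" using bchoice[of Q is_cut] by blast
    then have cut: "is_cut w (cut w)" if "w \<in> Q" for w using that by blast
    define C where "C = N \<times> {..n} \<times> {..n}"
    have "cut w \<in> C" if "w \<in> Q" for w
      using cut[OF that] len[OF that] by (auto simp: is_cut_def C_def)
    then have "cut ` Q \<subseteq> C" by (rule image_subsetI)
    moreover have "finite C" using P by (simp add: C_def N_def)
    moreover have "card C < card Q"
      using many by (simp add: C_def card_cartesian_product power2_eq_square)
    ultimately have "\<not> inj_on cut Q" using card_inj_on_le by (metis leD)
    then obtain w w' where ww: "w \<in> Q" "w' \<in> Q" "w \<noteq> w'" "cut w = cut w'"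
      unfolding inj_on_def by blast
    obtain B i l where "cut w = (B, i, l)" by (cases "cut w")
    then have "is_cut w (B, i, l)" "is_cut w' (B, i, l)" using cut[of w] cut[of w'] ww by simp_all
    then obtain u x v u' x' v' where
      w: "w = u @ x @ v" "length u = i" "length x = l" "l \<le> m" "m < d * l"
      and w': "w' = u' @ x' @ v'" "length u' = i" "length x' = l"
      and x': "yields P [Nt B] x'" and swap: "\<forall>x'. yields P [Nt B] x' \<longrightarrow> u @ x' @ v \<in> L"
      unfolding is_cut_def prod.case by (elim conjE exE) blast
    have "u @ x @ v \<in> Q" "u' @ x' @ v' \<in> Q" "u @ x @ v \<noteq> u' @ x' @ v'"
      using ww(1-3) unfolding w(1) w'(1) .
    moreover have "u @ x' @ v \<in> L" using swap x' by blast
    moreover have "length u = length u'" "length x = length x'" "length x \<le> m" "m < d * length x"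
      using w(2-5) w'(2,3) by simp_all
    ultimately show "interchangeable L d m Q"
      unfolding interchangeable_def
      by (intro exI[of _ u] exI[of _ x] exI[of _ v] exI[of _ u'] exI[of _ x'] exI[of _ v'] conjI)
  qed
qed

section \<open>The periodic Thue-Morse sequence\<close>

text \<open>
  The sequence obtained from the constant sequence \<open>False\<close> by applying \<open>k\<close> times the Thue-Morse
  morphism \<open>False \<mapsto> False True\<close>, \<open>True \<mapsto> True False\<close>; it repeats the Thue-Morse prefix of
  length \<open>2 ^ k\<close>. Being infinite it has no borders to take care of.
\<close>

fun tm :: "nat \<Rightarrow> nat \<Rightarrow> bool" where
  "tm 0 j = False"
| "tm (Suc k) j = (tm k (j div 2) \<noteq> odd j)"

lemma tm_periodic: "tm k (j + 2 ^ k) = tm k j"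
proof (induction k arbitrary: j)
  case (Suc k)
  have "(j + 2 ^ Suc k) div 2 = j div 2 + 2 ^ k" by simp
  moreover have "odd (j + 2 ^ Suc k) = odd j" by simp
  ultimately show ?case by (simp only: tm.simps Suc.IH)
qed simp

text \<open>
  Adjacent letters \<open>2 * j\<close> and \<open>2 * j + 1\<close> always differ. For an odd period \<open>q\<close> the shift by \<open>q\<close>
  carries this to the other pairs of neighbours, so that the letters alternate on the first
  \<open>q + 1\<close> positions and the first and the last of these differ, against periodicity. An overlap with
  an even period stems from an overlap with half that period in the sequence before the last
  application of the morphism.
\<close>

lemma tm_overlap_period:
  assumes "0 < q" and "\<And>j. \<lbrakk>i \<le> j; j \<le> i + q\<rbrakk> \<Longrightarrow> tm k (j + q) = tm k j"
  shows "2 ^ k \<le> q"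
  using assms
proof (induction k arbitrary: i q)
  case 0
  then show ?case by simp
next
  case (Suc k)
  have even_neighbours: "tm (Suc k) (Suc j) \<noteq> tm (Suc k) j" if "even j" for j
    using that by simp
  show ?case
  proof (cases "even q")
    case True
    then obtain h where h: "q = 2 * h" by (elim evenE)
    have "tm k (j + h) = tm k j" if "i div 2 \<le> j" "j \<le> i div 2 + h" for j
    proof (cases "even i")
      case True
      \<comment> \<open>The overlap starts at the first letter of a pair, and first letters determine their pairs.\<close>
      have "tm (Suc k) (2 * j + q) = tm (Suc k) (2 * j)"
        using that even_two_times_div_two[OF True] h by (intro Suc.prems(2)) linarith+
      then show ?thesis by (simp add: h)
    next
      case False
      \<comment> \<open>It starts at a second letter of a pair; second letters determine their pairs as well.\<close>
      have "tm (Suc k) ((2 * j + 1) + q) = tm (Suc k) (2 * j + 1)"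
        using that odd_two_times_div_two_succ[OF False] h by (intro Suc.prems(2)) linarith+
      moreover have "(2 * j + 1) + q = 2 * (j + h) + 1" using h by simp
      ultimately show ?thesis by simp
    qed
    then have "2 ^ k \<le> h" using Suc.prems(1) h by (intro Suc.IH[of h "i div 2"]) simp_all
    then show ?thesis using h by simp
  next
    case False
    have alternate: "tm (Suc k) (Suc j) \<noteq> tm (Suc k) j" if "i \<le> j" "j < i + q" for j
    proof (cases "even j")
      case True
      then show ?thesis by (rule even_neighbours)
    next
      case odd: False
      then have "tm (Suc k) (Suc (j + q)) \<noteq> tm (Suc k) (j + q)"
        using False by (intro even_neighbours) simp
      then show ?thesis using Suc.prems(2)[of j] Suc.prems(2)[of "Suc j"] that by (simp del: tm.simps)
    qed
    have "tm (Suc k) (i + l) = (tm (Suc k) i \<noteq> odd l)" if "l \<le> q" for l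
      using that
    proof (induction l)
      case (Suc l)
      then show ?case using alternate[of "i + l"] by (auto simp del: tm.simps)
    qed simp
    from this[of q] have "tm (Suc k) (i + q) \<noteq> tm (Suc k) i" using False by blast
    moreover have "tm (Suc k) (i + q) = tm (Suc k) i" by (rule Suc.prems(2)) simp_all
    ultimately show ?thesis by blast
  qed
qed

section \<open>A large family of overlaps\<close>

text \<open>
  The letter \<open>1\<close> of the Thue-Morse sequence becomes a \<open>2\<close> in those pairs of positions
  \<open>2 * j\<close>, \<open>2 * j + 1\<close> whose number \<open>j\<close> lies in \<open>D\<close> modulo \<open>b\<close>. Pairs are the natural unit, as each
  of them has exactly one letter \<open>1\<close> to carry the information.
\<close>

definition coloured :: "nat \<Rightarrow> nat \<Rightarrow> nat set \<Rightarrow> nat \<Rightarrow> nat" where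
  "coloured k b D j = (if tm k j then if (j div 2) mod b \<in> D then 2 else 1 else 0)"

definition coloured_word :: "nat \<Rightarrow> nat \<Rightarrow> nat set \<Rightarrow> nat list" where
  "coloured_word k b D = map (coloured k b D) [0..<2 * 2 ^ k + 1]"

lemma length_coloured_word [simp]: "length (coloured_word k b D) = 2 * 2 ^ k + 1"
  by (simp add: coloured_word_def)

lemma nth_coloured_word: "j < 2 * 2 ^ k + 1 \<Longrightarrow> coloured_word k b D ! j = coloured k b D j"
  unfolding coloured_word_def by (subst nth_map) (simp_all del: upt_Suc)

lemma coloured_periodic:
  assumes "2 * b dvd 2 ^ k"
  shows "coloured k b D (j + 2 ^ k) = coloured k b D j"
proof -
  from assms obtain c where c: "2 ^ k = 2 * b * c" by (elim dvdE)
  then have "(j + 2 ^ k) div 2 = j div 2 + b * c" by simp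
  then show ?thesis by (simp add: coloured_def tm_periodic)
qed

lemma coloured_word_in_overlap_lang:
  assumes "2 * b dvd 2 ^ k"
  shows "coloured_word k b D \<in> overlap_lang 3"
proof -
  let ?f = "coloured k b D" and ?p = "2 ^ k :: nat"
  define x where "x = map ?f [1..<?p]"
  have block: "map ?f [0..<?p] = ?f 0 # x" by (simp add: x_def upt_conv_Cons)
  have "map ?f [?p..<?p + ?p] = map ?f [0..<?p]"
    using coloured_periodic[OF assms, of D] by (intro nth_equalityI) (simp_all add: add.commute)
  moreover have "?f (2 * ?p) = ?f 0"
    using coloured_periodic[OF assms, of D 0] coloured_periodic[OF assms, of D ?p]
    by (simp add: mult_2)
  moreover have "[0..<2 * ?p + 1] = [0..<?p] @ [?p..<?p + ?p] @ [2 * ?p]"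
    using upt_add_eq_append[of 0 ?p ?p] by (simp add: mult_2)
  ultimately have "coloured_word k b D = [?f 0] @ x @ [?f 0] @ x @ [?f 0]"
    unfolding coloured_word_def using block by simp
  then have "overlap (coloured_word k b D)" unfolding overlap_def by blast
  moreover have "set (coloured_word k b D) \<subseteq> {..<3}"
    by (auto simp: coloured_word_def coloured_def)
  ultimately show ?thesis unfolding overlap_lang_def by blast
qed

text \<open>
  The window has room for \<open>b\<close> consecutive complete pairs, hence for one of each residue modulo \<open>b\<close>.
\<close>

lemma window_determines_colouring:
  assumes "0 < k" "0 < b" "2 * b + 1 \<le> l" "D \<subseteq> {..<b}" "D' \<subseteq> {..<b}"
    and eq: "\<And>j. \<lbrakk>i \<le> j; j < i + l\<rbrakk> \<Longrightarrow> coloured k b D j = coloured k b D' j"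
  shows "D = D'"
proof -
  have "r \<in> D \<longleftrightarrow> r \<in> D'" if "r < b" for r
  proof -
    define a where "a = (i + 1) div 2"
    \<comment> \<open>The number of the first pair from \<open>a\<close> on that is congruent to \<open>r\<close>; adding \<open>a * b\<close> keeps the
      difference from being truncated.\<close>
    define t where "t = a + (r + a * b - a) mod b"
    have "a \<le> a * b" using \<open>0 < b\<close> by simp
    then have "a + (r + a * b - a) = r + a * b" by linarith
    then have "t mod b = r"
      using that unfolding t_def by (simp only: mod_add_right_eq mod_mult_self1 mod_less)
    have "t < a + b" using \<open>0 < b\<close> by (simp add: t_def)
    moreover have "a \<le> t" by (simp add: t_def)
    ultimately have t: "i \<le> 2 * t" "2 * t + 1 < i + l"
      using assms(3) unfolding a_def by linarith+
    obtain k' where k': "k = Suc k'" using \<open>0 < k\<close> by (cases k) auto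
    have "tm k (2 * t) \<or> tm k (2 * t + 1)" by (simp add: k')
    then obtain j where j: "j = 2 * t \<or> j = 2 * t + 1" "tm k j" by blast
    then have "(j div 2) mod b = r" using \<open>t mod b = r\<close> by auto
    moreover have "coloured k b D j = coloured k b D' j" using j t by (intro eq) auto
    ultimately show ?thesis using j(2) by (auto simp: coloured_def split: if_splits)
  qed
  then show ?thesis using assms(4,5) by blast
qed

section \<open>Interchanging factors destroys the overlaps\<close>

lemma sublist_overlap_nth:
  assumes "sublist u w" and "overlap u"
  obtains i q where "0 < q" "i + 2 * q < length w"
    "\<And>j. \<lbrakk>i \<le> j; j \<le> i + q\<rbrakk> \<Longrightarrow> w ! (j + q) = w ! j"
proof -
  obtain p s where w: "w = p @ u @ s" using assms(1) by (auto simp: sublist_def)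
  obtain a x where u: "u = [a] @ x @ [a] @ x @ [a]" using assms(2) by (auto simp: overlap_def)
  let ?q = "length x + 1"
  have u_periodic: "u ! (j + ?q) = u ! j" if "j \<le> ?q" for j
    using that by (auto simp: u nth_append nth_Cons split: nat.splits)
  show thesis
  proof (rule that)
    show "length p + 2 * ?q < length w" by (simp add: w u)
    fix j assume j: "length p \<le> j" "j \<le> length p + ?q"
    then obtain t where t: "j = length p + t" by (metis le_add_diff_inverse)
    have "w ! (length p + t') = u ! t'" if "t' < length u" for t'
      using that by (simp add: w nth_append)
    from this[of t] this[of "t + ?q"] show "w ! (j + ?q) = w ! j"
      using j u_periodic[of t] unfolding t by (simp add: u add.assoc)
  qed simp
qed

text \<open>
  An overlap in \<open>w\<close> is also one in the pattern, so its period is at least \<open>2 ^ k\<close>; but then it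
  only fits into \<open>w\<close> by filling it.
\<close>

lemma overlap_of_tm_pattern:
  assumes "length w = 2 * 2 ^ k + 1" and pattern: "\<And>j. j < length w \<Longrightarrow> w ! j \<noteq> 0 \<longleftrightarrow> tm k j"
    and "w \<in> overlap_lang 3" and "j \<le> 2 ^ k"
  shows "w ! (j + 2 ^ k) = w ! j"
proof -
  obtain u where "sublist u w" "overlap u" using assms(3) by (auto simp: overlap_lang_def)
  then obtain i q where iq: "0 < q" "i + 2 * q < length w"
    and per: "\<And>j. \<lbrakk>i \<le> j; j \<le> i + q\<rbrakk> \<Longrightarrow> w ! (j + q) = w ! j"
    using sublist_overlap_nth by metis
  have "tm k (j + q) = tm k j" if "i \<le> j" "j \<le> i + q" for j
  proof -
    have "j < length w" "j + q < length w" using that iq by linarith+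
    then show ?thesis using pattern per[OF that] by metis
  qed
  then have "2 ^ k \<le> q" using tm_overlap_period[OF iq(1)] by blast
  then have "q = 2 ^ k" "i = 0" using iq(2) assms(1) by linarith+
  with per show ?thesis using assms(4) by simp
qed

text \<open>
  The mixed word \<open>u x' v\<close> still shows the Thue-Morse pattern, so it can only be an overlap as a
  whole, with period \<open>2 ^ k\<close>. Since the window is not longer than the period, the partner of a window
  position at distance \<open>2 ^ k\<close> lies outside of the window, where the mixed word agrees with
  \<open>u x v\<close>.
\<close>

lemma interchanged_window_eq:
  assumes w: "coloured_word k b D = u @ x @ v" and w': "coloured_word k b D' = u' @ x' @ v'"
    and len: "length u = length u'" "length x = length x'" "length x \<le> 2 ^ k"
    and mixed: "u @ x' @ v \<in> overlap_lang 3" and dvd: "2 * b dvd 2 ^ k"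
    and j: "length u \<le> j" "j < length u + length x"
  shows "coloured k b D j = coloured k b D' j"
proof -
  define h where "h = u @ x' @ v"
  let ?p = "2 ^ k :: nat"
  have n: "length u + length x + length v = 2 * ?p + 1"
    using arg_cong[OF w, of length] by simp
  have outside: "h ! t = coloured k b D t"
    if "t < length u \<or> length u + length x \<le> t" "t < 2 * ?p + 1" for t
  proof -
    have "h ! t = (u @ x @ v) ! t"
      using that len(2) by (auto simp: h_def nth_append)
    also have "\<dots> = coloured k b D t"
      unfolding w[symmetric] using that by (intro nth_coloured_word) linarith
    finally show ?thesis .
  qed
  have inside: "h ! t = coloured k b D' t" if "length u \<le> t" "t < length u + length x" for t
  proof -
    have "h ! t = (u' @ x' @ v') ! t"
      using that len by (auto simp: h_def nth_append)
    also have "\<dots> = coloured k b D' t"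
      unfolding w'[symmetric] using that n by (intro nth_coloured_word) linarith
    finally show ?thesis .
  qed
  have h_length: "length h = 2 * ?p + 1" using n len(2) by (simp add: h_def)
  have pattern: "h ! t \<noteq> 0 \<longleftrightarrow> tm k t" if "t < length h" for t
  proof -
    have "h ! t = coloured k b D t \<or> h ! t = coloured k b D' t"
      using inside[of t] outside[of t] that h_length by linarith
    then show ?thesis by (auto simp: coloured_def split: if_splits)
  qed
  have periodic: "h ! (t + ?p) = h ! t" if "t \<le> ?p" for t
    using mixed that by (intro overlap_of_tm_pattern[OF h_length pattern]) (simp_all only: h_def)
  show ?thesis
  proof (cases "j < ?p")
    case True
    have "coloured k b D j = coloured k b D (j + ?p)" by (rule coloured_periodic[OF dvd, symmetric])
    also have "\<dots> = h ! (j + ?p)"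
      using True j len(3) by (intro outside[symmetric]) linarith+
    also have "\<dots> = h ! j" using True by (intro periodic) linarith
    also have "\<dots> = coloured k b D' j" by (rule inside[OF j])
    finally show ?thesis .
  next
    case False
    then obtain t where t: "j = t + ?p" by (metis add.commute le_add_diff_inverse not_less)
    have "coloured k b D j = coloured k b D t" unfolding t by (rule coloured_periodic[OF dvd])
    also have "\<dots> = h ! t" using t j len(3) n by (intro outside[symmetric]) linarith+
    also have "\<dots> = h ! j" unfolding t using t j n by (intro periodic[symmetric]) linarith
    also have "\<dots> = coloured k b D' j" by (rule inside[OF j])
    finally show ?thesis .
  qed
qed

section \<open>Overlaps over three letters\<close>

theorem theorem3: "\<not> context_free (overlap_lang 3)"
proof
  assume "context_free (overlap_lang 3)"
  then obtain d c :: nat where interchange: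
    "\<And>n m Q. \<lbrakk>d \<le> m; m < n; Q \<subseteq> overlap_lang 3; finite Q; \<forall>w\<in>Q. length w = n;
      c * (n + 1)\<^sup>2 < card Q\<rbrakk> \<Longrightarrow> interchangeable (overlap_lang 3) d m Q"
    using context_free_interchange by metis
  \<comment> \<open>This \<open>e\<close> makes \<open>2 ^ (2 ^ e)\<close> exceed the number of cuts and \<open>2 ^ e\<close> exceed \<open>2 * d\<close>, so that a
    factor longer than \<open>2 ^ k / d\<close> contains all residues modulo \<open>2 ^ e\<close>.\<close>
  define e where "e = c + 2 * d + 5"
  define b where "b = (2 :: nat) ^ e"
  have "e < b" by (simp add: b_def)
  then have b: "2 * d + 1 < b" by (simp add: e_def)
  define k where "k = 2 * e"
  have p: "2 ^ k = b\<^sup>2" by (simp add: k_def b_def power2_eq_square mult_2 power_add)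
  have "Suc e \<le> k" by (simp add: k_def e_def)
  then have "(2 :: nat) ^ Suc e dvd 2 ^ k" by (rule le_imp_power_dvd)
  then have dvd: "2 * b dvd 2 ^ k" by (simp add: b_def)
  have large: "c * (2 * 2 ^ k + 1 + 1)\<^sup>2 < 2 ^ b"
  proof -
    have "2 * 2 ^ k + 1 + 1 \<le> (2 :: nat) ^ (k + 2)"
      using one_le_power[of "2 :: nat" k] by simp
    then have "(2 * 2 ^ k + 1 + 1)\<^sup>2 \<le> ((2 :: nat) ^ (k + 2))\<^sup>2"
      by (rule power_mono) simp
    also have "\<dots> = 2 ^ (4 * e + 4)" by (simp add: k_def flip: power_mult) (simp add: power_add)
    finally have "c * (2 * 2 ^ k + 1 + 1)\<^sup>2 \<le> c * 2 ^ (4 * e + 4)" by simp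
    also have "\<dots> < 2 ^ c * 2 ^ (4 * e + 4)" by simp
    also have "\<dots> = 2 ^ (c + (4 * e + 4))" by (simp add: power_add)
    also have "\<dots> \<le> 2 ^ b"
    proof (rule power_increasing)
      have "5 * (5 + t) + 4 \<le> (2 :: nat) ^ (5 + t)" for t
        by (induction t) (simp_all add: power_add)
      from this[of "c + 2 * d"] show "c + (4 * e + 4) \<le> b"
        by (simp add: b_def e_def add.commute)
    qed simp
    finally show ?thesis .
  qed
  define Q where "Q = coloured_word k b ` Pow {..<b}"
  have k_pos: "0 < k" and b_pos: "0 < b" by (simp_all add: k_def e_def b_def)
  have "inj_on (coloured_word k b) (Pow {..<b})"
  proof (rule inj_onI)
    fix D D' assume D: "D \<in> Pow {..<b}" "D' \<in> Pow {..<b}"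
      and eq: "coloured_word k b D = coloured_word k b D'"
    have "2 * b + 1 \<le> 2 * 2 ^ k + 1" using dvd_imp_le[OF dvd] by simp
    then show "D = D'"
    proof (rule window_determines_colouring[OF k_pos b_pos])
      show "coloured k b D j = coloured k b D' j" if "j < 0 + (2 * 2 ^ k + 1)" for j
        using that eq nth_coloured_word by (metis add_0)
    qed (use D in auto)
  qed
  then have "card Q = 2 ^ b" by (simp add: Q_def card_image card_Pow)
  then have "c * (2 * 2 ^ k + 1 + 1)\<^sup>2 < card Q" using large by simp
  moreover have "d \<le> 2 ^ k" using b self_le_power[of b 2] by (simp add: p)
  moreover have "Q \<subseteq> overlap_lang 3"
    using coloured_word_in_overlap_lang[OF dvd] by (auto simp: Q_def)
  moreover have "finite Q" "\<forall>w\<in>Q. length w = 2 * 2 ^ k + 1" by (auto simp: Q_def)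
  ultimately have "interchangeable (overlap_lang 3) d (2 ^ k) Q"
    by (intro interchange[of "2 ^ k" "2 * 2 ^ k + 1"]) simp_all
  then obtain u x v u' x' v' where
    Q: "u @ x @ v \<in> Q" "u' @ x' @ v' \<in> Q" "u @ x @ v \<noteq> u' @ x' @ v'"
    and len: "length u = length u'" "length x = length x'" "length x \<le> 2 ^ k"
    and long: "2 ^ k < d * length x" and mixed: "u @ x' @ v \<in> overlap_lang 3"
    unfolding interchangeable_def by (elim exE conjE)
  obtain D D' where D: "D \<subseteq> {..<b}" "coloured_word k b D = u @ x @ v"
    and D': "D' \<subseteq> {..<b}" "coloured_word k b D' = u' @ x' @ v'"
    using Q(1,2) by (auto simp: Q_def)
  have "2 * b + 1 \<le> length x"
  proof (rule ccontr)
    assume "\<not> ?thesis"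
    then have "d * length x \<le> d * (2 * b)" by simp
    also have "\<dots> \<le> b * b" using b by (simp add: mult.assoc[symmetric])
    finally show False using long by (simp add: p power2_eq_square)
  qed
  then have "D = D'"
    using window_determines_colouring[OF k_pos b_pos _ D(1) D'(1)]
      interchanged_window_eq[OF D(2) D'(2) len mixed dvd] by blast
  then show False using Q(3) D(2) D'(2) by simp
qed

end
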